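(* Let $N$ be a Nijenhuis operator on a pre-Lie algebra $(\mathfrak g,\cdot_{\mathfrak g})$. Then a deformation of $(\mathfrak g,\cdot_{\mathfrak g})$ can be obtained by putting $$\omega(x,y)=(\mathrm d^{\rm reg}N)(x,y)=N(x)\cdot_{\mathfrak g}y+x\cdot_{\mathfrak g}N(y)-N(x\cdot_{\mathfrak g}y),\qquad \forall x,y\in\mathfrak g.$$ Furthermore, this deformation is trivial.
   Context: $\mathbb K$ is an algebraically closed field of characteristic $0$; vector spaces are finite dimensional over $\mathbb K$. A pre-Lie algebra is a vector space $\mathfrak g$ with a bilinear product $\cdot_{\mathfrak g}$ such that $(x\cdot_{\mathfrak g} y)\cdot_{\mathfrak g} z-x\cdot_{\mathfrak g}(y\cdot_{\mathfrak g} z)$ is symmetric in $x,y$. Write $\pi(x,y)=x\cdot_{\mathfrak g}y$. A linear map $N:\mathfrak g\to\mathfrak g$ is a Nijenhuis operator on $(\mathfrak g,\cdot_{\mathfrak g})$ if $N(x)\cdot_{\mathfrak g}N(y)=N\big(N(x)\cdot_{\mathfrak g}y+x\cdot_{\mathfrak g}N(y)-N(x\cdot_{\mathfrak g}y)\big)$ for all $x,y\in\mathfrak g$. $\mathrm d^{\rm reg}$ is the coboundary operator of the pre-Lie algebra associated to its regular representation (left and right multiplications on $\mathfrak g$); on a linear map $N:\mathfrak g\to\mathfrak g$ it is given by the formula displayed in the claim. For $\omega\in\mathrm{Hom}(\otimes^2\mathfrak g,\mathfrak g)$, consider the $t$-parameterized family of multiplications $\pi_t(x,y)=\pi(x,y)+t\,\omega(x,y)$.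 If $\mathfrak g_t=(\mathfrak g,\pi_t)$ is a pre-Lie algebra for all $t$, one says that $\omega$ generates a (1-parameter infinitesimal) deformation of $(\mathfrak g,\pi)$. A deformation is said to be trivial if there exists a family of pre-Lie algebra isomorphisms $\mathrm{Id}+tN:\mathfrak g_t\to(\mathfrak g,\pi)$, where $N:\mathfrak g\to\mathfrak g$ is a linear map.
   Formalization: "Trivial" is taken to mean that Id+tN is a homomorphism for all t and an isomorphism for all but finitely many t; requiring isomorphisms for every t fails for g=K, N=Id, t=-1, where the deformed product is zero. *)

theory Defs
  imports "HOL-Computational_Algebra.Polynomial"
begin

definition bilinear_map :: "('k::field \<Rightarrow> 'v::ab_group_add \<Rightarrow> 'v) \<Rightarrow> ('v \<Rightarrow> 'v \<Rightarrow> 'v) \<Rightarrow> bool" where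
  "bilinear_map scale p \<longleftrightarrow>
     (\<forall>y. Vector_Spaces.linear scale scale (\<lambda>x. p x y)) \<and>
     (\<forall>x. Vector_Spaces.linear scale scale (\<lambda>y. p x y))"

locale pre_lie_algebra = vector_space scale
  for scale :: "'k::field \<Rightarrow> 'v::ab_group_add \<Rightarrow> 'v"
    and p :: "'v \<Rightarrow> 'v \<Rightarrow> 'v" +
  assumes bilinear: "bilinear_map scale p"
    and left_symmetric: "p (p x y) z - p x (p y z) = p (p y x) z - p y (p x z)"

locale pre_lie_hom =
  dom: pre_lie_algebra scale1 p1 + cod: pre_lie_algebra scale2 p2 +
  Vector_Spaces.linear scale1 scale2 f
  for scale1 :: "'k::field \<Rightarrow> 'v::ab_group_add \<Rightarrow> 'v" and p1 :: "'v \<Rightarrow> 'v \<Rightarrow> 'v"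
    and scale2 :: "'k \<Rightarrow> 'w::ab_group_add \<Rightarrow> 'w" and p2 :: "'w \<Rightarrow> 'w \<Rightarrow> 'w"
    and f :: "'v \<Rightarrow> 'w" +
  assumes hom_mult: "f (p1 x y) = p2 (f x) (f y)"

locale pre_lie_iso = pre_lie_hom +
  assumes bij: "bij f"

definition nijenhuis_operator ::
  "('k::field \<Rightarrow> 'v::ab_group_add \<Rightarrow> 'v) \<Rightarrow> ('v \<Rightarrow> 'v \<Rightarrow> 'v) \<Rightarrow> ('v \<Rightarrow> 'v) \<Rightarrow> bool" where
  "nijenhuis_operator scale p N \<longleftrightarrow>
     Vector_Spaces.linear scale scale N \<and>
     (\<forall>x y. p (N x) (N y) = N (p (N x) y + p x (N y) - N (p x y)))"

text \<open>The coboundary operator of the regular representation, in degree one.\<close>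

definition d_reg :: "('v::ab_group_add \<Rightarrow> 'v \<Rightarrow> 'v) \<Rightarrow> ('v \<Rightarrow> 'v) \<Rightarrow> 'v \<Rightarrow> 'v \<Rightarrow> 'v" where
  "d_reg p N x y = p (N x) y + p x (N y) - N (p x y)"

definition deformed_product ::
  "('k::field \<Rightarrow> 'v::ab_group_add \<Rightarrow> 'v) \<Rightarrow> ('v \<Rightarrow> 'v \<Rightarrow> 'v) \<Rightarrow> ('v \<Rightarrow> 'v \<Rightarrow> 'v) \<Rightarrow> 'k \<Rightarrow> 'v \<Rightarrow> 'v \<Rightarrow> 'v"
  where "deformed_product scale p \<omega> t x y = p x y + scale t (\<omega> x y)"

definition generates_deformation ::
  "('k::field \<Rightarrow> 'v::ab_group_add \<Rightarrow> 'v) \<Rightarrow> ('v \<Rightarrow> 'v \<Rightarrow> 'v) \<Rightarrow> ('v \<Rightarrow> 'v \<Rightarrow> 'v) \<Rightarrow> bool" where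
  "generates_deformation scale p \<omega> \<longleftrightarrow>
     bilinear_map scale \<omega> \<and> (\<forall>t. pre_lie_algebra scale (deformed_product scale p \<omega> t))"

text \<open>
  The map \<open>Id + tN\<close> is not invertible when \<open>t \<noteq> 0\<close> and \<open>-1/t\<close> is an eigenvalue of \<open>N\<close>, so a
  family of isomorphisms \<open>Id + tN\<close> is understood for generic \<open>t\<close>: every member is a
  homomorphism, and all but finitely many members are isomorphisms. Bijectivity cannot be
  demanded for every \<open>t\<close>: for \<open>N = Id\<close> and \<open>t = -1\<close> the deformed product by \<open>d_reg p N\<close> is zero,
  so it is not isomorphic to a nonzero \<open>p\<close> under any map.
\<close>

definition trivial_deformation ::
  "('k::field \<Rightarrow> 'v::ab_group_add \<Rightarrow> 'v) \<Rightarrow> ('v \<Rightarrow> 'v \<Rightarrow> 'v) \<Rightarrow> ('v \<Rightarrow> 'v \<Rightarrow> 'v) \<Rightarrow> bool" where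
  "trivial_deformation scale p \<omega> \<longleftrightarrow>
     (\<exists>N. Vector_Spaces.linear scale scale N \<and>
        (\<forall>t. pre_lie_hom scale (deformed_product scale p \<omega> t) scale p (\<lambda>x. x + scale t (N x))) \<and>
        finite {t. \<not> pre_lie_iso scale (deformed_product scale p \<omega> t) scale p
                        (\<lambda>x. x + scale t (N x))})"

end

theory Submission
  imports Defs
begin

text \<open>
  Put \<open>\<delta> = d_reg p N\<close>, let \<open>p\<^sub>t = p + t \<delta>\<close> be the deformed product and \<open>f\<^sub>t = Id + tN\<close>. The identity
  \<open>f\<^sub>t (p\<^sub>t x y) = p (f\<^sub>t x) (f\<^sub>t y)\<close> compares polynomials in \<open>t\<close>: its linear part is the formula for
  \<open>\<delta>\<close>, and its quadratic part, \<open>N (\<delta> x y) = p (N x) (N y)\<close>, is the Nijenhuis condition.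

  For a product \<open>q\<close> let \<open>A q x y z\<close> measure how far its associator is from being symmetric in
  \<open>x\<close> and \<open>y\<close>. The homomorphism identity gives \<open>f\<^sub>t (A p\<^sub>t x y z) = A p (f\<^sub>t x) (f\<^sub>t y) (f\<^sub>t z)\<close>, which
  vanishes since \<open>p\<close> is pre-Lie. If \<open>A p\<^sub>t = A\<^sub>0 + t A\<^sub>1 + t\<^sup>2 A\<^sub>2\<close>, then \<open>A\<^sub>0 = A p = 0\<close>, the
  coefficient of \<open>t\<close> shows \<open>A\<^sub>1 = 0\<close>, and that of \<open>t\<^sup>2\<close>, which is \<open>A\<^sub>2 + N A\<^sub>1\<close>, shows \<open>A\<^sub>2 = 0\<close>.
  These are \<open>first_order_defect_eq_0\<close> and \<open>defect_d_reg_eq_0\<close>; their proofs state the two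
  coefficient identities directly and so avoid inverting \<open>f\<^sub>t\<close> or specialising \<open>t\<close>. Hence every
  \<open>p\<^sub>t\<close> is a pre-Lie product.

  Finally \<open>f\<^sub>t\<close> fails to be bijective only if \<open>t \<noteq> 0\<close> and \<open>-1/t\<close> is an eigenvalue of \<open>N\<close>. In finite
  dimension \<open>N\<close> has finitely many eigenvalues, because eigenvectors for distinct eigenvalues are
  linearly independent. So all but finitely many \<open>f\<^sub>t\<close> are isomorphisms and the deformation is
  trivial.
\<close>

section \<open>Eigenvectors and the invertibility of \<open>Id + tN\<close>\<close>

text \<open>
  Applying \<open>N - \<mu> w\<close> to a linear relation kills the term at \<open>w\<close> and multiplies each other
  coefficient by the nonzero number \<open>\<mu> v - \<mu> w\<close>; this drives an induction on the number of terms.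
\<close>

lemma (in vector_space) independent_eigenvectors:
  assumes lin: "Vector_Spaces.linear scale scale N"
    and nz: "0 \<notin> X" and inj: "inj_on \<mu> X"
    and eig: "\<And>v. v \<in> X \<Longrightarrow> N v = scale (\<mu> v) v"
  shows "independent X"
proof -
  interpret N: Vector_Spaces.linear scale scale N by (fact lin)
  have key: "\<forall>v\<in>S. c v = 0"
    if "finite S" "S \<subseteq> X" "(\<Sum>v\<in>S. scale (c v) v) = 0" for S c
    using that
  proof (induction S arbitrary: c rule: finite_induct)
    case empty
    then show ?case by simp
  next
    case (insert w S)
    have sum0: "scale (c w) w + (\<Sum>v\<in>S. scale (c v) v) = 0"
      using insert by simp
    have "0 = N (scale (c w) w + (\<Sum>v\<in>S. scale (c v) v))
              - scale (\<mu> w) (scale (c w) w + (\<Sum>v\<in>S. scale (c v) v))"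
      by (simp only: sum0 N.zero scale_zero_right diff_self)
    also have "\<dots> = (scale (c w) (scale (\<mu> w) w) + (\<Sum>v\<in>S. scale (c v) (scale (\<mu> v) v)))
              - scale (\<mu> w) (scale (c w) w + (\<Sum>v\<in>S. scale (c v) v))"
      using insert.prems(1) eig
      by (auto simp: N.add N.scale N.sum intro!: sum.cong)
    also have "\<dots> = (\<Sum>v\<in>S. scale (c v * (\<mu> v - \<mu> w)) v)"
      by (simp add: scale_right_distrib scale_sum_right sum_subtractf algebra_simps)
    finally have "\<forall>v\<in>S. c v * (\<mu> v - \<mu> w) = 0"
      using insert.IH[of "\<lambda>v. c v * (\<mu> v - \<mu> w)"] insert.prems(1) by simp
    moreover have "\<mu> v \<noteq> \<mu> w" if "v \<in> S" for v
      using inj that insert.hyps(2) insert.prems(1) by (auto dest: inj_onD)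
    ultimately have S0: "\<forall>v\<in>S. c v = 0" by auto
    then have "scale (c w) w = 0" using sum0 by simp
    moreover have "w \<noteq> 0" using nz insert.prems(1) by auto
    ultimately show ?case using S0 by simp
  qed
  then show ?thesis unfolding dependent_explicit by blast
qed

text \<open>
  Choosing one eigenvector for each eigenvalue gives an independent set, which is finite.
\<close>

lemma (in finite_dimensional_vector_space) finite_eigenvalues:
  assumes lin: "Vector_Spaces.linear scale scale N"
  shows "finite {l. \<exists>v. v \<noteq> 0 \<and> N v = scale l v}" (is "finite ?E")
proof -
  obtain e where e: "\<And>l. l \<in> ?E \<Longrightarrow> e l \<noteq> 0 \<and> N (e l) = scale l (e l)"
    using bchoice[of ?E "\<lambda>l v. v \<noteq> 0 \<and> N v = scale l v"] by auto
  have inj: "inj_on e ?E"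
  proof (rule inj_onI)
    fix k l assume kl: "k \<in> ?E" "l \<in> ?E" "e k = e l"
    then have "scale k (e l) = scale l (e l)" "e l \<noteq> 0"
      using e[OF kl(1)] e[OF kl(2)] kl(3) by metis+
    then show "k = l" by simp
  qed
  have "independent (e ` ?E)"
  proof (rule independent_eigenvectors[OF lin, where \<mu> = "inv_into ?E e"])
    show "0 \<notin> e ` ?E" using e by force
    show "inj_on (inv_into ?E e) (e ` ?E)" by (simp add: inj_on_inv_into)
    show "N v = scale (inv_into ?E e v) v" if v: "v \<in> e ` ?E" for v
      using e[OF inv_into_into[OF v]] f_inv_into_f[OF v] by simp
  qed
  then have "finite (e ` ?E)" by (rule finiteI_independent)
  then show ?thesis using inj by (rule finite_imageD)
qed

text \<open>
  In finite dimension a non-bijective \<open>Id + tN\<close> has a nonzero kernel vector, and such a vector is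
  an eigenvector of \<open>N\<close> with eigenvalue \<open>-1/t\<close>.
\<close>

lemma (in finite_dimensional_vector_space) finite_not_bij_id_plus_scale:
  assumes lin: "Vector_Spaces.linear scale scale N"
  shows "finite {t. \<not> bij (\<lambda>x. x + scale t (N x))}" (is "finite ?T")
proof -
  interpret N: Vector_Spaces.linear scale scale N by (fact lin)
  have "?T \<subseteq> (\<lambda>l. - inverse l) ` {l. \<exists>v. v \<noteq> 0 \<and> N v = scale l v}"
  proof
    fix t assume t: "t \<in> ?T"
    let ?f = "\<lambda>x. x + scale t (N x)"
    have f: "Vector_Spaces.linear scale scale ?f"
      by unfold_locales (simp_all add: N.add N.scale algebra_simps)
    then have "\<not> inj ?f"
      using t linear_inj_imp_surj[OF f] by (auto simp: bij_def)
    then obtain x y where xy: "x \<noteq> y" "?f x = ?f y" by (auto simp: inj_def)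
    define v where "v = x - y"
    have v: "v \<noteq> 0" "v + scale t (N v) = 0"
      using xy by (simp_all add: v_def N.diff scale_right_diff_distrib algebra_simps)
    then have t0: "t \<noteq> 0" by auto
    have "scale (inverse t) (v + scale t (N v)) = 0" using v by simp
    then have "N v = scale (- inverse t) v"
      using t0 by (simp add: scale_right_distrib eq_neg_iff_add_eq_0 add.commute)
    then show "t \<in> (\<lambda>l. - inverse l) ` {l. \<exists>v. v \<noteq> 0 \<and> N v = scale l v}"
      using v t0 by (intro image_eqI[of _ _ "- inverse t"]) auto
  qed
  then show ?thesis
    by (rule finite_subset) (intro finite_imageI finite_eigenvalues lin)
qed

section \<open>The deformation generated by a Nijenhuis operator\<close>

lemma (in vector_space) bilinear_map_iff:
  "bilinear_map scale q \<longleftrightarrow>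
     (\<forall>x y z. q (x + y) z = q x z + q y z) \<and> (\<forall>c x z. q (scale c x) z = scale c (q x z)) \<and>
     (\<forall>x y z. q z (x + y) = q z x + q z y) \<and> (\<forall>c x z. q z (scale c x) = scale c (q z x))"
proof -
  interpret vector_space_pair scale scale ..
  show ?thesis
    unfolding bilinear_map_def Vector_Spaces.linear_iff using vector_space_axioms by auto
qed

definition left_symmetry_defect :: "('v::ab_group_add \<Rightarrow> 'v \<Rightarrow> 'v) \<Rightarrow> 'v \<Rightarrow> 'v \<Rightarrow> 'v \<Rightarrow> 'v" where
  "left_symmetry_defect q x y z = q (q x y) z - q x (q y z) - (q (q y x) z - q y (q x z))"

locale nijenhuis_pre_lie_algebra = pre_lie_algebra scale p
  for scale :: "'k::field \<Rightarrow> 'v::ab_group_add \<Rightarrow> 'v" and p :: "'v \<Rightarrow> 'v \<Rightarrow> 'v" +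
  fixes N :: "'v \<Rightarrow> 'v"
  assumes nijenhuis: "nijenhuis_operator scale p N"
begin

abbreviation \<delta> :: "'v \<Rightarrow> 'v \<Rightarrow> 'v" where
  "\<delta> \<equiv> d_reg p N"

abbreviation deformed :: "'k \<Rightarrow> 'v \<Rightarrow> 'v \<Rightarrow> 'v" where
  "deformed \<equiv> deformed_product scale p \<delta>"

lemma linear_N: "Vector_Spaces.linear scale scale N"
  using nijenhuis by (simp add: nijenhuis_operator_def)

sublocale N: Vector_Spaces.linear scale scale N
  by (fact linear_N)

text \<open>
  In this form the Nijenhuis condition says that \<open>N\<close> carries \<open>\<delta>\<close> to \<open>p\<close>.
\<close>

lemma N_d_reg: "N (\<delta> x y) = p (N x) (N y)"
  using nijenhuis by (simp add: nijenhuis_operator_def d_reg_def)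

lemma p_bilinear:
  "p (x + y) z = p x z + p y z" "p (scale c x) z = scale c (p x z)"
  "p z (x + y) = p z x + p z y" "p z (scale c x) = scale c (p z x)"
  using bilinear unfolding bilinear_map_iff by auto

lemma p_diff: "p (x - y) z = p x z - p y z" "p z (x - y) = p z x - p z y"
  using p_bilinear(1)[of "x - y" y z] p_bilinear(3)[of z "x - y" y] by (simp_all add: eq_diff_eq)

lemma bilinear_d_reg: "bilinear_map scale \<delta>"
  unfolding bilinear_map_iff d_reg_def
  by (simp add: p_bilinear N.add N.scale algebra_simps)

lemma d_reg_bilinear:
  "\<delta> (x + y) z = \<delta> x z + \<delta> y z" "\<delta> (scale c x) z = scale c (\<delta> x z)"
  "\<delta> z (x + y) = \<delta> z x + \<delta> z y" "\<delta> z (scale c x) = scale c (\<delta> z x)"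
  using bilinear_d_reg unfolding bilinear_map_iff by auto

lemma defect_p: "left_symmetry_defect p x y z = 0"
  using left_symmetric[of x y z] by (simp add: left_symmetry_defect_def)

text \<open>
  The coefficient of \<open>t\<close> in the left-symmetry defect of \<open>p + t \<delta>\<close>; its vanishing is the condition
  that \<open>\<delta>\<close> is a 2-cocycle for the regular representation.
\<close>

definition first_order_defect :: "'v \<Rightarrow> 'v \<Rightarrow> 'v \<Rightarrow> 'v" where
  "first_order_defect x y z =
     \<delta> (p x y) z + p (\<delta> x y) z - \<delta> x (p y z) - p x (\<delta> y z)
     - (\<delta> (p y x) z + p (\<delta> y x) z - \<delta> y (p x z) - p y (\<delta> x z))"

lemma defect_deformed:
  "left_symmetry_defect (deformed t) x y z =
     left_symmetry_defect p x y z + scale t (first_order_defect x y z)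
     + scale (t ^ 2) (left_symmetry_defect \<delta> x y z)"
  unfolding left_symmetry_defect_def first_order_defect_def deformed_product_def
  by (simp add: p_bilinear d_reg_bilinear power2_eq_square algebra_simps)

text \<open>
  The coboundary \<open>\<delta>\<close> of \<open>N\<close> is a cocycle. This is the infinitesimal form of the naturality of the
  defect: \<open>\<delta>\<close> is the derivative at \<open>t = 0\<close> of \<open>p\<close> transported along \<open>Id + tN\<close>, so the first-order
  change of the defect is obtained by letting \<open>N\<close> act as a derivation on its arguments and value.
\<close>

lemma first_order_defect_eq_0: "first_order_defect x y z = 0"
proof -
  have "first_order_defect x y z =
      left_symmetry_defect p (N x) y z + left_symmetry_defect p x (N y) z
      + left_symmetry_defect p x y (N z) - N (left_symmetry_defect p x y z)"
    unfolding first_order_defect_def left_symmetry_defect_def d_reg_def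
    by (simp add: p_bilinear p_diff N.add N.diff algebra_simps)
  then show ?thesis by (simp add: defect_p)
qed

text \<open>
  This is the coefficient of \<open>t\<^sup>2\<close> in the naturality of the defect under \<open>Id + tN\<close>: on the right,
  \<open>N\<close> is inserted in two of the three arguments in every possible way. The Nijenhuis condition
  enters wherever \<open>N\<close> is applied to a value of \<open>\<delta>\<close>.
\<close>

lemma defect_d_reg_eq_0: "left_symmetry_defect \<delta> x y z = 0"
proof -
  \<comment> \<open>Only the outer \<open>\<delta>\<close> is expanded here, so that \<open>N (\<delta> u v)\<close> can be rewritten by the Nijenhuis
    condition before the inner \<open>\<delta>\<close> is unfolded.\<close>
  have outer: "\<delta> (\<delta> u v) w = p (p (N u) (N v)) w + p (\<delta> u v) (N w) - N (p (\<delta> u v) w)"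
    "\<delta> w (\<delta> u v) = p w (p (N u) (N v)) + p (N w) (\<delta> u v) - N (p w (\<delta> u v))" for u v w
    by (simp_all add: d_reg_def[of p N "\<delta> u v" w] d_reg_def[of p N w "\<delta> u v"] N_d_reg)
  have "left_symmetry_defect \<delta> x y z + N (first_order_defect x y z) =
      left_symmetry_defect p (N x) (N y) z + left_symmetry_defect p (N x) y (N z)
      + left_symmetry_defect p x (N y) (N z)"
    unfolding left_symmetry_defect_def first_order_defect_def outer
    by (simp add: N.add N.diff N_d_reg)
       (simp add: d_reg_def p_bilinear p_diff algebra_simps)
  then show ?thesis by (simp add: defect_p first_order_defect_eq_0)
qed

lemma pre_lie_algebra_deformed: "pre_lie_algebra scale (deformed t)"
proof
  show "bilinear_map scale (deformed t)"
    unfolding bilinear_map_iff deformed_product_def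
    by (simp add: p_bilinear d_reg_bilinear algebra_simps)
  show "deformed t (deformed t x y) z - deformed t x (deformed t y z) =
      deformed t (deformed t y x) z - deformed t y (deformed t x z)" for x y z
    using defect_deformed[of t x y z]
    by (simp add: defect_p first_order_defect_eq_0 defect_d_reg_eq_0)
       (simp add: left_symmetry_defect_def)
qed

theorem generates_deformation_d_reg: "generates_deformation scale p \<delta>"
  using bilinear_d_reg pre_lie_algebra_deformed by (simp add: generates_deformation_def)

text \<open>
  Both sides are quadratic in \<open>t\<close>: the terms in \<open>t\<close> agree by the definition of \<open>\<delta>\<close>, those in
  \<open>t\<^sup>2\<close> by the Nijenhuis condition.
\<close>

lemma pre_lie_hom_deformed:
  "pre_lie_hom scale (deformed t) scale p (\<lambda>x. x + scale t (N x))"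
proof -
  interpret D: pre_lie_algebra scale "deformed t" by (fact pre_lie_algebra_deformed)
  show ?thesis
  proof
    fix x y
    let ?f = "\<lambda>x. x + scale t (N x)"
    have "?f (deformed t x y) =
        p x y + scale t (\<delta> x y + N (p x y)) + scale t (scale t (N (\<delta> x y)))"
      by (simp add: deformed_product_def N.add N.scale algebra_simps)
    also have "\<dots> = p (?f x) (?f y)"
      unfolding N_d_reg by (simp add: d_reg_def p_bilinear algebra_simps)
    finally show "?f (deformed t x y) = p (?f x) (?f y)" .
  qed (simp_all add: N.add N.scale algebra_simps)
qed

theorem trivial_deformation_d_reg:
  assumes "finite_dimensional_vector_space scale B"
  shows "trivial_deformation scale p \<delta>"
proof -
  interpret V: finite_dimensional_vector_space scale B by fact
  have "pre_lie_iso scale (deformed t) scale p (\<lambda>x. x + scale t (N x))"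
    if "bij (\<lambda>x. x + scale t (N x))" for t
    using pre_lie_hom_deformed that by (simp add: pre_lie_iso_def pre_lie_iso_axioms_def)
  then have "{t. \<not> pre_lie_iso scale (deformed t) scale p (\<lambda>x. x + scale t (N x))}
      \<subseteq> {t. \<not> bij (\<lambda>x. x + scale t (N x))}"
    by auto
  then have "finite {t. \<not> pre_lie_iso scale (deformed t) scale p (\<lambda>x. x + scale t (N x))}"
    by (rule finite_subset) (rule V.finite_not_bij_id_plus_scale[OF linear_N])
  then show ?thesis
    unfolding trivial_deformation_def using linear_N pre_lie_hom_deformed by blast
qed

end

theorem theorem4p9:
  fixes scale :: "'k::{alg_closed_field, field_char_0} \<Rightarrow> 'v::ab_group_add \<Rightarrow> 'v"
    and B :: "'v set"
    and p :: "'v \<Rightarrow> 'v \<Rightarrow> 'v"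
    and N :: "'v \<Rightarrow> 'v"
    and \<omega> :: "'v \<Rightarrow> 'v \<Rightarrow> 'v"
  assumes "finite_dimensional_vector_space scale B"
    and "pre_lie_algebra scale p"
    and "nijenhuis_operator scale p N"
    and "\<And>x y. \<omega> x y = d_reg p N x y"
  shows "(\<forall>x y. \<omega> x y = p (N x) y + p x (N y) - N (p x y)) \<and>
         generates_deformation scale p \<omega> \<and>
         trivial_deformation scale p \<omega>"
proof -
  interpret nijenhuis_pre_lie_algebra scale p N
    using assms(2,3) by (simp add: nijenhuis_pre_lie_algebra_def nijenhuis_pre_lie_algebra_axioms_def)
  have "\<omega> = d_reg p N" using assms(4) by (intro ext)
  then show ?thesis
    using generates_deformation_d_reg trivial_deformation_d_reg[OF assms(1)]
    by (simp add: d_reg_def)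
qed

end
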